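(* Consider the Game of Cards with $p$ players and $n$ cards, and let $O$ be a configuration. Let $a$ and $b$ be two non-dual configurations reachable from $O$. Then $b$ is reachable from $a$ with $b\neq a$ if and only if $s(O,a)<s(O,b)$, where $<$ denotes the componentwise order on $\mathbb Z^p$ ($x<y$ iff $x_i\le y_i$ for all $i$ and $x\neq y$).
   Context: Game of Cards: $p$ players sit in a cycle; indices are taken modulo $p$ (player $p$'s right neighbor is player $1$). A configuration is a vector $(a_1,\dots,a_p)$ of nonnegative integers with sum $n$. A move at position $i$ is allowed in $a$ iff $a_i>a_{i+1}$ (with $a_{p+1}=a_1$); it replaces $a_i$ by $a_i-1$ and $a_{i+1}$ by $a_{i+1}+1$. Reachability means existence of a finite sequence of moves. Let $\mathcal G$ be the directed graph on configurations with an arc $a\to b$ whenever $b$ is obtained from $a$ by one move; a configuration is dual if it lies on a directed cycle of positive length in $\mathcal G$, non-dual otherwise. The shot vector of a sequence of moves is the vector whose $i$-th entry is the number of moves at position $i$. For a non-dual configuration $a$ reachable from $O$, $s(O,a)$ denotes the shot vector of any sequence of moves from $O$ to $a$ (all such sequences have the same shot vector). *)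

theory Defs
  imports Main
begin

text \<open>
  Players are numbered from 0, so a configuration of \<open>p\<close> players is a list of length \<open>p\<close>,
  and the right neighbour of player \<open>i\<close> is player \<open>(i + 1) mod p\<close>.
\<close>

type_synonym config = "nat list"

definition configs :: "nat \<Rightarrow> nat \<Rightarrow> config set" where
  "configs p n = {a. length a = p \<and> sum_list a = n}"

definition right :: "config \<Rightarrow> nat \<Rightarrow> nat" where
  "right a i = (i + 1) mod length a"

definition allowed :: "config \<Rightarrow> nat \<Rightarrow> bool" where
  "allowed a i \<longleftrightarrow> i < length a \<and> a ! i > a ! right a i"

text \<open>
  Only used when \<open>allowed a i\<close> holds: then \<open>a ! i\<close> is positive, so the subtraction does not
  truncate, and \<open>right a i\<close> differs from \<open>i\<close>.
\<close>

definition move :: "config \<Rightarrow> nat \<Rightarrow> config" where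
  "move a i = a[i := a ! i - 1, right a i := a ! right a i + 1]"

fun play :: "config \<Rightarrow> nat list \<Rightarrow> config \<Rightarrow> bool" where
  "play a [] b \<longleftrightarrow> a = b"
| "play a (i # ms) b \<longleftrightarrow> allowed a i \<and> play (move a i) ms b"

definition reachable :: "config \<Rightarrow> config \<Rightarrow> bool" where
  "reachable a b \<longleftrightarrow> (\<exists>ms. play a ms b)"

definition game_graph :: "nat \<Rightarrow> nat \<Rightarrow> (config \<times> config) set" where
  "game_graph p n =
     {(a, b). a \<in> configs p n \<and> b \<in> configs p n \<and> (\<exists>i. allowed a i \<and> b = move a i)}"

text \<open>
  A vertex lies on a directed cycle of positive length iff it lies on a closed walk of positive
  length, since a shortest such walk does not repeat vertices.
\<close>

definition dual :: "nat \<Rightarrow> nat \<Rightarrow> config \<Rightarrow> bool" where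
  "dual p n a \<longleftrightarrow> (a, a) \<in> (game_graph p n)\<^sup>+"

definition shot_vector :: "nat \<Rightarrow> nat list \<Rightarrow> int list" where
  "shot_vector p ms = map (\<lambda>i. int (count_list ms i)) [0..<p]"

text \<open>
  The description below is meaningful only where the shot vector does not depend on the chosen
  sequence of moves, as is the case for a non-dual \<open>b\<close> reachable from \<open>a\<close>.
\<close>

definition shot :: "nat \<Rightarrow> config \<Rightarrow> config \<Rightarrow> int list" where
  "shot p a b = (THE v. \<exists>ms. play a ms b \<and> v = shot_vector p ms)"

definition vec_less :: "int list \<Rightarrow> int list \<Rightarrow> bool" where
  "vec_less x y \<longleftrightarrow> list_all2 (\<le>) x y \<and> x \<noteq> y"

end

theory Submission
  imports Defs
begin

text \<open>
  A move elsewhere never disables an allowed move, and distinct allowed moves commute. Hence an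
  allowed move that occurs in a play can be pulled to its front, and a play can be extended to any
  other play from the same configuration whose move counts dominate its own. Two plays
  with the same endpoints have move counts differing by a constant, because the net flow through
  every player is the same. So they are comparable, and if they differ, then the extension is
  a closed walk of positive length at the common endpoint, which is impossible for a non-dual one.
\<close>

lemma length_move [simp]: "length (move a i) = length a"
  by (simp add: move_def)

lemma right_move [simp]: "right (move a i) j = right a j"
  by (simp add: right_def)

lemma right_less_length: "i < length a \<Longrightarrow> right a i < length a"
  unfolding right_def by (rule mod_less_divisor) linarith

lemma right_neq_self: "allowed a i \<Longrightarrow> right a i \<noteq> i"
  by (auto simp: allowed_def)

text \<open>Each player has only one left neighbour, so moves at distinct positions feed distinct
  players.\<close>

lemma right_eq_iff:
  assumes "i < length a" "j < length a"
  shows "right a i = right a j \<longleftrightarrow> i = j"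
  using assms by (auto simp: right_def mod_Suc split: if_splits)

lemma nth_move:
  assumes "allowed a i" "k < length a"
  shows "move a i ! k = (if k = i then a ! i - 1 else if k = right a i then a ! k + 1 else a ! k)"
  using assms right_neq_self[OF assms(1)] by (auto simp: move_def nth_list_update)

text \<open>The move at \<open>i\<close> lowers only entry \<open>i\<close>, which is not
  \<open>j\<close>, and raises only \<open>right a i\<close>, which is not \<open>right a j\<close>.
  So the drop from \<open>j\<close> to its right neighbour cannot shrink.\<close>

lemma allowed_move:
  assumes "allowed a i" "allowed a j" "i \<noteq> j"
  shows "allowed (move a i) j"
proof -
  have j: "j < length a" and i: "i < length a" and gt: "a ! right a j < a ! j"
    using assms by (auto simp: allowed_def)
  have "right a j \<noteq> right a i"
    using right_eq_iff[OF j i] assms(3) by auto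
  then show ?thesis
    using j gt assms(3) right_less_length[OF j] unfolding allowed_def
    by (auto simp: nth_move[OF assms(1)])
qed

lemma move_commute:
  assumes "allowed a i" "allowed a j" "i \<noteq> j"
  shows "move (move a i) j = move (move a j) i"
proof (rule nth_equalityI)
  fix k assume "k < length (move (move a i) j)"
  then have k: "k < length a" by simp
  \<comment> \<open>Positivity keeps the natural subtractions exact, so both orders add the same
    vector to \<open>a\<close>.\<close>
  have len: "i < length a" "j < length a"
    and pos: "0 < a ! i" "0 < a ! j"
    using assms by (auto simp: allowed_def)
  have "right a j \<noteq> right a i"
    using right_eq_iff[OF len] assms(3) by auto
  then show "move (move a i) j ! k = move (move a j) i ! k"
    using k len pos assms right_neq_self[OF assms(1)] right_neq_self[OF assms(2)]
      allowed_move[OF assms] allowed_move[OF assms(2,1)]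
    by (auto simp: nth_move)
qed simp

lemma move_in_configs:
  assumes "a \<in> configs p n" "allowed a i"
  shows "move a i \<in> configs p n"
proof -
  have i: "i < length a" and gt: "a ! right a i < a ! i"
    using assms by (auto simp: allowed_def)
  \<comment> \<open>The bound rules out truncation in the subtraction that
    \<open>sum_list_update\<close> introduces.\<close>
  have "a ! i \<le> sum_list a"
    using i by (simp add: member_le_sum_list)
  then have "sum_list (move a i) = sum_list a"
    using i gt right_neq_self[OF assms(2)] right_less_length[OF i]
    by (simp add: move_def sum_list_update)
  then show ?thesis
    using assms by (simp add: configs_def)
qed

lemma play_append: "play a (xs @ ys) c \<longleftrightarrow> (\<exists>b. play a xs b \<and> play b ys c)"
  by (induction xs arbitrary: a) auto

lemma play_rtrancl:
  assumes "play a ms b" "a \<in> configs p n"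
  shows "(a, b) \<in> (game_graph p n)\<^sup>*"
  using assms
proof (induction ms arbitrary: a)
  case (Cons i ms)
  then have "(a, move a i) \<in> game_graph p n"
    by (auto simp: game_graph_def move_in_configs)
  with Cons show ?case
    by (auto intro: converse_rtrancl_into_rtrancl simp: move_in_configs)
qed simp

lemma closed_play_dual:
  assumes "play a ms a" "ms \<noteq> []" "a \<in> configs p n"
  shows "dual p n a"
proof -
  obtain i ks where ms: "ms = i # ks"
    using assms(2) by (cases ms) auto
  then have "(a, move a i) \<in> game_graph p n" "(move a i, a) \<in> (game_graph p n)\<^sup>*"
    using assms play_rtrancl by (auto simp: game_graph_def move_in_configs)
  then show ?thesis
    unfolding dual_def by (rule rtrancl_into_trancl2)
qed

text \<open>Every move before the first \<open>i\<close> is at another position, so \<open>i\<close>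
  stays allowed throughout and can be swapped forward past these moves one by one.\<close>

lemma play_remove1:
  assumes "play a ms c" "allowed a i" "i \<in> set ms"
  shows "play (move a i) (remove1 i ms) c"
  using assms
proof (induction ms arbitrary: a)
  case (Cons j ms)
  show ?case
  proof (cases "j = i")
    case False
    then have "play (move (move a j) i) (remove1 i ms) c"
      using Cons by (auto intro: allowed_move)
    with False Cons.prems show ?thesis
      by (auto simp: allowed_move move_commute)
  qed (use Cons.prems in auto)
qed simp

lemma count_list_remove1:
  "count_list (remove1 x xs) y = (if x = y then count_list xs y - 1 else count_list xs y)"
  by (induction xs) (auto simp: Suc_diff_Suc count_notin)

text \<open>The first move of \<open>xs\<close> is allowed at \<open>a\<close> and, by the counts,
  occurs in \<open>ys\<close>. Pulling it to the front of \<open>ys\<close> and cancelling it on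
  both sides leaves a shorter instance starting at \<open>move a i\<close>.\<close>

lemma play_extension:
  assumes "play a xs b" "play a ys c" "\<And>i. count_list xs i \<le> count_list ys i"
  obtains zs where "play b zs c" "\<And>i. count_list xs i + count_list zs i = count_list ys i"
  using assms
proof (induction xs arbitrary: a ys thesis)
  case (Cons i xs)
  have i: "i \<in> set ys"
    using Cons.prems(4)[of i] by (cases "i \<in> set ys") simp_all
  have "play (move a i) (remove1 i ys) c"
    using Cons.prems i by (auto intro: play_remove1)
  moreover have "count_list xs k \<le> count_list (remove1 i ys) k" for k
    using Cons.prems(4)[of k] by (auto simp: count_list_remove1)
  ultimately obtain zs where zs: "play b zs c"
      "\<And>k. count_list xs k + count_list zs k = count_list (remove1 i ys) k"
    using Cons.IH[where a = "move a i" and ys = "remove1 i ys"] Cons.prems by auto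
  have "count_list (i # xs) k + count_list zs k = count_list ys k" for k
    using zs(2)[of k] Cons.prems(4)[of k] by (auto simp: count_list_remove1)
  with zs(1) show ?case by (rule Cons.prems(1))
qed auto

text \<open>Cards are conserved at the player \<open>right a i\<close>: moves at \<open>i\<close>
  bring one card in, moves at \<open>right a i\<close> send one out. The additive form avoids
  natural subtraction.\<close>

lemma play_flow:
  assumes "play a ms b" "i < length a"
  shows "b ! right a i + count_list ms (right a i) = a ! right a i + count_list ms i"
  using assms
proof (induction ms arbitrary: a)
  case (Cons j ms)
  have j: "allowed a j" "j < length a" "0 < a ! j"
    using Cons.prems by (auto simp: allowed_def)
  have "b ! right a i + count_list ms (right a i) = move a j ! right a i + count_list ms i"
    using Cons.IH[of "move a j"] Cons.prems by simp
  then show ?case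
    using j right_neq_self[OF j(1)] right_eq_iff[OF Cons.prems(2) j(2)]
      right_less_length[OF Cons.prems(2)]
    by (auto simp: nth_move)
qed simp

lemma play_count_outside: "play a ms b \<Longrightarrow> length a \<le> i \<Longrightarrow> count_list ms i = 0"
  by (induction ms arbitrary: a) (fastforce simp: allowed_def)+

lemma play_count_difference:
  assumes "play a xs b" "play a ys b" "i < length a"
  shows "int (count_list ys i) - int (count_list xs i)
       = int (count_list ys 0) - int (count_list xs 0)"
  using assms(3)
proof (induction i)
  case (Suc i)
  \<comment> \<open>No wrap-around occurs here, since \<open>Suc i\<close> is still a player.
    Comparing the flows of both plays through that player carries the difference from
    \<open>i\<close> to \<open>Suc i\<close>.\<close>
  then have "right a i = Suc i" by (simp add: right_def)
  then show ?case
    using play_flow[OF assms(1), of i] play_flow[OF assms(2), of i] Suc by simp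
qed simp

lemma nondual_count_unique_aux:
  assumes "play a xs b" "play a ys b" "b \<in> configs p n" "\<not> dual p n b"
    "count_list xs 0 \<le> count_list ys 0"
  shows "count_list xs = count_list ys"
proof -
  \<comment> \<open>The constant difference has the sign seen at player 0. Outside the cycle
    \<open>xs\<close> has no moves.\<close>
  have "count_list xs i \<le> count_list ys i" for i
    using play_count_difference[OF assms(1,2), of i] assms(5)
      play_count_outside[OF assms(1), of i]
    by (cases "i < length a") auto
  then obtain zs where zs: "play b zs b"
      "\<And>i. count_list xs i + count_list zs i = count_list ys i"
    using play_extension[OF assms(1,2)] by blast
  then have "zs = []"
    using closed_play_dual assms(3,4) by blast
  then show ?thesis using zs(2) by auto
qed

lemma nondual_count_unique:
  assumes "play a xs b" "play a ys b" "b \<in> configs p n" "\<not> dual p n b"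
  shows "count_list xs = count_list ys"
  using nondual_count_unique_aux[OF assms] nondual_count_unique_aux[OF assms(2,1,3,4)]
  by (metis nat_le_linear)

text \<open>Uniqueness of the counts justifies the definite description in \<open>shot\<close>, so
  any play at hand computes it.\<close>

lemma shot_eq:
  assumes "play a ms b" "b \<in> configs p n" "\<not> dual p n b"
  shows "shot p a b = shot_vector p ms"
  unfolding shot_def
proof (rule the_equality)
  fix v assume "\<exists>ks. play a ks b \<and> v = shot_vector p ks"
  then show "v = shot_vector p ms"
    using nondual_count_unique[OF assms(1) _ assms(2,3)] by (auto simp: shot_vector_def)
qed (use assms in auto)

lemma vec_less_shot_vector_iff:
  "vec_less (shot_vector p xs) (shot_vector p ys) \<longleftrightarrow>
    (\<forall>i<p. count_list xs i \<le> count_list ys i) \<and> (\<exists>i<p. count_list xs i \<noteq> count_list ys i)"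
  by (auto simp: vec_less_def shot_vector_def list_all2_conv_all_nth)

theorem theorem3:
  fixes p n :: nat and orig a b :: config
  assumes "p \<ge> 1"
    and "orig \<in> configs p n"
    and "a \<in> configs p n" and "reachable orig a" and "\<not> dual p n a"
    and "b \<in> configs p n" and "reachable orig b" and "\<not> dual p n b"
  shows "(reachable a b \<and> b \<noteq> a) \<longleftrightarrow> vec_less (shot p orig a) (shot p orig b)"
proof
  obtain xs where xs: "play orig xs a"
    using assms by (auto simp: reachable_def)
  have shot_a: "shot p orig a = shot_vector p xs"
    using shot_eq[OF xs assms(3,5)] .
  {
    assume "reachable a b \<and> b \<noteq> a"
    then obtain zs where zs: "play a zs b" "zs \<noteq> []"
      unfolding reachable_def by (metis play.simps(1))
    then have "play orig (xs @ zs) b"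
      using xs by (auto simp: play_append)
    then have shot_b: "shot p orig b = shot_vector p (xs @ zs)"
      using shot_eq assms(6,8) by blast
    obtain i ks where i: "zs = i # ks"
      using zs(2) by (cases zs) auto
    \<comment> \<open>Strictness needs an extra move at a coordinate that the shot vector records;
      the first move of \<open>zs\<close> is one.\<close>
    then have "i < p"
      using zs(1) assms(3) by (auto simp: allowed_def configs_def)
    then show "vec_less (shot p orig a) (shot p orig b)"
      unfolding shot_a shot_b vec_less_shot_vector_iff using i by force
  next
    assume less: "vec_less (shot p orig a) (shot p orig b)"
    obtain ys where ys: "play orig ys b"
      using assms by (auto simp: reachable_def)
    have "shot p orig b = shot_vector p ys"
      using shot_eq[OF ys assms(6,8)] .
    then have "\<forall>i<p. count_list xs i \<le> count_list ys i"
      using less shot_a by (simp add: vec_less_shot_vector_iff)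
    \<comment> \<open>Shot vectors compare only the indices below \<open>p\<close>, whereas
      \<open>play_extension\<close> asks for all indices; beyond \<open>p\<close> the counts of
      \<open>xs\<close> vanish.\<close>
    moreover have "length orig = p"
      using assms(2) by (simp add: configs_def)
    ultimately have "count_list xs i \<le> count_list ys i" for i
      using play_count_outside[OF xs, of i] by (cases "i < p") auto
    then have "reachable a b"
      using play_extension[OF xs ys] unfolding reachable_def by blast
    \<comment> \<open>\<open>shot\<close> depends only on the endpoints, so \<open>b = a\<close>
      would make both vectors equal.\<close>
    moreover have "b \<noteq> a"
      using less by (auto simp: vec_less_def)
    ultimately show "reachable a b \<and> b \<noteq> a" ..
  }
qed

end
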